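(* Let $\Gamma$ be a Dedekind group and let $C$ be a finite inclusion-minimal generating set of $\Gamma$. Then the Cayley graph $\mathrm{Cay}(\Gamma,C)$ is $3$-colorable.
   Context: A group is Dedekind if all of its subgroups are normal. For a group $\Gamma$ and a subset $C\subseteq\Gamma$, the Cayley graph $\mathrm{Cay}(\Gamma,C)$ is the undirected graph with vertex set $\Gamma$ in which $a,b\in\Gamma$ are adjacent if $a^{-1}b\in C$; it is undirected even if $C$ is not inverse-closed. *)

theory Defs
  imports "HOL-Algebra.Generated_Groups" "Graph_Theory.Pair_Digraph"
begin

definition dedekind_group :: "('a, 'b) monoid_scheme \<Rightarrow> bool" where
  "dedekind_group G \<longleftrightarrow> group G \<and> (\<forall>H. subgroup H G \<longrightarrow> H \<lhd> G)"

definition minimal_generating_set :: "('a, 'b) monoid_scheme \<Rightarrow> 'a set \<Rightarrow> bool" where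
  "minimal_generating_set G C \<longleftrightarrow>
     C \<subseteq> carrier G \<and> generate G C = carrier G \<and> (\<forall>D. D \<subset> C \<longrightarrow> generate G D \<noteq> carrier G)"

text \<open>
  Undirected graphs are symmetric digraphs, as elsewhere in the Graph-Theory library.
  The two disjuncts make the arc set symmetric without assuming that \<open>C\<close> is closed under
  inverses. There is a loop at every vertex if \<open>C\<close> contains the identity, but an
  inclusion-minimal generating set never does (see \<open>cayley_graph_loopfree\<close>).
\<close>
definition cayley_graph :: "('a, 'b) monoid_scheme \<Rightarrow> 'a set \<Rightarrow> 'a pair_pre_digraph" where
  "cayley_graph G C =
     \<lparr> pverts = carrier G,
       parcs = {(a, b). a \<in> carrier G \<and> b \<in> carrier G \<and>
                  (inv\<^bsub>G\<^esub> a \<otimes>\<^bsub>G\<^esub> b \<in> C \<or> inv\<^bsub>G\<^esub> b \<otimes>\<^bsub>G\<^esub> a \<in> C)} \<rparr>"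

definition colorable :: "nat \<Rightarrow> ('a, 'b) pre_digraph \<Rightarrow> bool" where
  "colorable k X \<longleftrightarrow>
     (\<exists>f. f \<in> verts X \<rightarrow> {..<k} \<and> (\<forall>u v. (u, v) \<in> arcs_ends X \<longrightarrow> f u \<noteq> f v))"

lemma cayley_graph_sym: "pair_sym_digraph (cayley_graph G C)"
  by unfold_locales (auto simp: cayley_graph_def symmetric_def sym_def)

lemma (in group) minimal_generating_set_not_one:
  assumes "minimal_generating_set G C"
  shows "\<one> \<notin> C"
proof
  assume "\<one> \<in> C"
  have C: "C \<subseteq> carrier G" "generate G C = carrier G"
    using assms by (auto simp: minimal_generating_set_def)
  have "subgroup (generate G (C - {\<one>})) G"
    using C(1) by (intro generate_is_subgroup) auto
  moreover have "C \<subseteq> generate G (C - {\<one>})"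
    using generate.incl[of _ "C - {\<one>}" G] generate.one[of G "C - {\<one>}"] by blast
  ultimately have "generate G C \<subseteq> generate G (C - {\<one>})"
    by (rule generate_subgroup_incl[rotated])
  moreover have "generate G (C - {\<one>}) \<subseteq> carrier G"
    using C(1) by (intro generate_incl) auto
  ultimately have "generate G (C - {\<one>}) = carrier G"
    using C(2) by auto
  moreover have "C - {\<one>} \<subset> C"
    using \<open>\<one> \<in> C\<close> by auto
  ultimately show False
    using assms by (auto simp: minimal_generating_set_def)
qed

lemma (in group) cayley_graph_loopfree:
  assumes "minimal_generating_set G C"
  shows "pair_loopfree_digraph (cayley_graph G C)"
  using minimal_generating_set_not_one[OF assms]
  by unfold_locales (auto simp: cayley_graph_def)

end

theory Submission
  imports Defs "HOL-Algebra.Multiplicative_Group" "HOL-Number_Theory.Cong"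
begin

text \<open>
  For \<open>c \<in> C\<close> let \<open>H\<^sub>c\<close> be the subgroup generated by \<open>C - {c}\<close>. It is normal, and by minimality
  \<open>c \<notin> H\<^sub>c\<close>, so the quotient by \<open>H\<^sub>c\<close> is a nontrivial cyclic group generated by the class of \<open>c\<close>.
  The Cayley graph of this quotient is a cycle, a single edge or a two-way infinite path, and has
  a colouring \<open>f\<^sub>c\<close> with values in \<open>{0, 1, 2}\<close>. Along an edge labelled \<open>d\<close> the class modulo \<open>H\<^sub>c\<close> does
  not change for \<open>c \<noteq> d\<close>, while \<open>f\<^sub>d\<close> changes; hence \<open>\<Sum>c\<in>C. f\<^sub>c\<close> modulo 3 is a proper colouring.
\<close>

text \<open>Parity separates consecutive residues, but can fail at the wrap-around from
  \<open>m - 1\<close> to 0 when \<open>m\<close> is odd; a third colour at \<open>m - 1\<close>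
  repairs this. For \<open>m = 1\<close> the only residue would be its own successor.\<close>

lemma periodic_three_coloring_int:
  fixes m :: int
  assumes "m \<ge> 0" "m \<noteq> 1"
  obtains g :: "int \<Rightarrow> nat"
  where "\<And>i. g i < 3" "\<And>i. g (i + 1) \<noteq> g i" "\<And>i j. m dvd i - j \<Longrightarrow> g i = g j"
proof
  \<comment> \<open>For \<open>m = 0\<close>, where \<open>i mod 0 = i\<close>, the same formula colours an infinite path.\<close>
  define h :: "int \<Rightarrow> nat" where "h r = (if r = m - 1 then 2 else if even r then 0 else 1)" for r
  show "h (i mod m) < 3" for i
    by (simp add: h_def)
  show "h (i mod m) = h (j mod m)" if "m dvd i - j" for i j
    using that by (metis mod_eq_dvd_iff)
  show "h ((i + 1) mod m) \<noteq> h (i mod m)" for i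
  proof (cases "i mod m = m - 1")
    case True
    have "(i + 1) mod m = (i mod m + 1) mod m"
      by (simp add: mod_add_left_eq)
    also have "\<dots> = 0"
      using True by simp
    \<comment> \<open>As \<open>m \<noteq> 1\<close>, the residue 0 differs from
      \<open>m - 1\<close>, so its colour is not 2.\<close>
    finally show ?thesis
      using True assms by (simp add: h_def)
  next
    case False
    have "(i + 1) mod m = (i mod m + 1) mod m"
      by (simp add: mod_add_left_eq)
    also have "\<dots> = i mod m + 1"
    proof (cases "m = 0")
      case nz: False
      have "0 \<le> i mod m" "i mod m < m"
        using assms nz by simp_all
      thus ?thesis
        using False by (intro mod_pos_pos_trivial) auto
    qed simp
    finally show ?thesis
      using False by (simp add: h_def)
  qed
qed

text \<open>Every element is a power of \<open>q\<close> with exponent unique modulo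
  \<open>ord q\<close>, so a colouring of the integers with that period transfers to the group.
  Infinite order is the case \<open>ord q = 0\<close>, and \<open>q \<noteq> \<one>\<close> excludes
  \<open>ord q = 1\<close>.\<close>

lemma (in group) cyclic_three_coloring:
  assumes q: "q \<in> carrier G" "q \<noteq> \<one>" and gen: "generate G {q} = carrier G"
  obtains g :: "'a \<Rightarrow> nat"
  where "\<And>x. g x < 3" "\<And>x. x \<in> carrier G \<Longrightarrow> g (x \<otimes> q) \<noteq> g x"
proof -
  obtain h :: "int \<Rightarrow> nat" where h: "\<And>i. h i < 3" "\<And>i. h (i + 1) \<noteq> h i"
      "\<And>i j. int (ord q) dvd i - j \<Longrightarrow> h i = h j"
    using periodic_three_coloring_int[of "int (ord q)"] ord_eq_1[OF q(1)] q(2) by auto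
  \<comment> \<open>Two exponents of the same element differ by a multiple of \<open>ord q\<close>,
    so the choice does not affect the colour.\<close>
  define g where "g x = h (SOME i. x = q [^] i)" for x
  have g_pow: "g (q [^] i) = h i" for i :: int
  proof -
    have "q [^] i = q [^] (SOME j :: int. q [^] i = q [^] j)"
      by (rule someI) (rule refl)
    thus ?thesis
      unfolding g_def using h(3) int_pow_eq[OF q(1)] by metis
  qed
  show thesis
  proof
    show "g x < 3" for x
      using h(1) by (simp add: g_def)
    show "g (x \<otimes> q) \<noteq> g x" if "x \<in> carrier G" for x
    proof -
      obtain i :: int where i: "x = q [^] i"
        using \<open>x \<in> carrier G\<close> gen generate_pow[OF q(1)] by auto
      have "x \<otimes> q = q [^] (i + 1)"
        using int_pow_mult[OF q(1), of i 1] q(1) by (simp add: i)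
      thus ?thesis
        using h(2) by (simp add: i g_pow)
    qed
  qed
qed

text \<open>The colouring is pulled back from \<open>G Mod H\<close> along the projection, which
  sends \<open>c\<close> to a nontrivial generator and collapses \<open>H\<close> to the
  identity.\<close>

lemma (in normal) three_coloring_of_cyclic_quotient:
  assumes c: "c \<in> carrier G" "c \<notin> H" and gen: "generate G (insert c H) = carrier G"
  obtains f :: "'a \<Rightarrow> nat"
  where "\<And>x. f x < 3" "\<And>x. x \<in> carrier G \<Longrightarrow> f (x \<otimes> c) \<noteq> f x"
    "\<And>x d. x \<in> carrier G \<Longrightarrow> d \<in> H \<Longrightarrow> f (x \<otimes> d) = f x"
proof -
  interpret Q: group "G Mod H"
    by (rule factorgroup_is_group)
  interpret proj: group_hom G "G Mod H" "(#>) H"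
    by unfold_locales (rule r_coset_hom_Mod)
  define q where "q = H #> c"
  have q: "q \<in> carrier (G Mod H)"
    using c(1) by (auto simp: q_def)
  have coset_H: "H #> d = \<one>\<^bsub>G Mod H\<^esub>" if "d \<in> H" for d
    using that by (simp add: FactGroup_def rcos_const)
  have "q \<noteq> \<one>\<^bsub>G Mod H\<^esub>"
    using c rcos_self[OF c(1) is_subgroup] by (auto simp: q_def FactGroup_def)
  \<comment> \<open>The generators from \<open>H\<close> become trivial in the quotient, so the
    image of \<open>c\<close> suffices.\<close>
  moreover have "generate (G Mod H) {q} = carrier (G Mod H)"
  proof
    have "carrier (G Mod H) = (#>) H ` generate G (insert c H)"
      by (auto simp: gen FactGroup_def RCOSETS_def)
    also have "\<dots> = generate (G Mod H) ((#>) H ` insert c H)"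
      using c(1) subset by (intro proj.generate_img[symmetric]) auto
    also have "\<dots> \<subseteq> generate (G Mod H) {q}"
    proof (rule Q.generate_subgroup_incl)
      show "(#>) H ` insert c H \<subseteq> generate (G Mod H) {q}"
        using coset_H generate.one[of "G Mod H" "{q}"] generate.incl[of q "{q}" "G Mod H"]
        by (auto simp: q_def)
      show "subgroup (generate (G Mod H) {q}) (G Mod H)"
        using q by (intro Q.generate_is_subgroup) auto
    qed
    finally show "carrier (G Mod H) \<subseteq> generate (G Mod H) {q}" .
    show "generate (G Mod H) {q} \<subseteq> carrier (G Mod H)"
      using q by (intro Q.generate_incl) auto
  qed
  ultimately obtain g :: "'a set \<Rightarrow> nat" where g: "\<And>x. g x < 3"
      "\<And>x. x \<in> carrier (G Mod H) \<Longrightarrow> g (x \<otimes>\<^bsub>G Mod H\<^esub> q) \<noteq> g x"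
    using Q.cyclic_three_coloring[OF q] by blast
  show thesis
  proof
    show "g (H #> x) < 3" for x
      by (rule g(1))
    show "g (H #> (x \<otimes> c)) \<noteq> g (H #> x)" if "x \<in> carrier G" for x
      using that g(2)[OF proj.hom_closed[OF that]] proj.hom_mult[OF that c(1)]
      by (simp add: q_def)
    show "g (H #> (x \<otimes> d)) = g (H #> x)" if "x \<in> carrier G" "d \<in> H" for x d
      using proj.hom_mult[OF that(1) mem_carrier[OF that(2)]] coset_H[OF that(2)]
        Q.r_one[OF proj.hom_closed[OF that(1)]] by simp
  qed
qed

lemma (in group) minimal_generating_set_notin_generate:
  assumes min: "minimal_generating_set G C" and c: "c \<in> C"
  shows "c \<notin> generate G (C - {c})"
proof
  assume "c \<in> generate G (C - {c})"
  hence "C \<subseteq> generate G (C - {c})"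
    using generate.incl[of _ "C - {c}" G] by blast
  moreover have C: "C \<subseteq> carrier G" "generate G C = carrier G"
    using min by (auto simp: minimal_generating_set_def)
  moreover have "subgroup (generate G (C - {c})) G"
    using C(1) by (intro generate_is_subgroup) auto
  ultimately have "carrier G \<subseteq> generate G (C - {c})"
    using generate_subgroup_incl by metis
  moreover have "generate G (C - {c}) \<subseteq> carrier G"
    using C(1) by (intro generate_incl) auto
  moreover have "C - {c} \<subset> C"
    using c by auto
  ultimately show False
    using min by (auto simp: minimal_generating_set_def)
qed

theorem theorem2p5:
  fixes G :: "('a, 'b) monoid_scheme" and C :: "'a set"
  assumes "dedekind_group G"
    and "finite C"
    and "minimal_generating_set G C"
  shows "colorable 3 (with_proj (cayley_graph G C))"
proof -
  interpret group G
    using assms(1) by (simp add: dedekind_group_def)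
  have C: "C \<subseteq> carrier G" "generate G C = carrier G"
    using assms(3) by (auto simp: minimal_generating_set_def)
  have "\<exists>f :: 'a \<Rightarrow> nat. (\<forall>x. f x < 3) \<and> (\<forall>x\<in>carrier G. f (x \<otimes>\<^bsub>G\<^esub> c) \<noteq> f x) \<and>
          (\<forall>x\<in>carrier G. \<forall>d\<in>C - {c}. f (x \<otimes>\<^bsub>G\<^esub> d) = f x)" if c: "c \<in> C" for c
  proof -
    define H where "H = generate G (C - {c})"
    have "subgroup H G"
      unfolding H_def using C(1) by (intro generate_is_subgroup) auto
    \<comment> \<open>The Dedekind property enters here: it makes the quotient by \<open>H\<close> a
      group.\<close>
    hence normal: "H \<lhd> G"
      using assms(1) by (simp add: dedekind_group_def)
    have sub: "C - {c} \<subseteq> H"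
      unfolding H_def using generate.incl[of _ "C - {c}" G] by blast
    have "insert c H \<subseteq> carrier G"
      using C(1) c subgroup.subset[OF \<open>subgroup H G\<close>] by auto
    hence "generate G (insert c H) \<subseteq> carrier G"
      by (rule generate_incl)
    moreover have "carrier G \<subseteq> generate G (insert c H)"
      unfolding C(2)[symmetric] using sub by (intro mono_generate) auto
    ultimately have "generate G (insert c H) = carrier G"
      by (rule equalityI)
    moreover have "c \<in> carrier G" "c \<notin> H"
      using C(1) c minimal_generating_set_notin_generate[OF assms(3) c] by (auto simp: H_def)
    ultimately obtain f :: "'a \<Rightarrow> nat" where "\<And>x. f x < 3"
        "\<And>x. x \<in> carrier G \<Longrightarrow> f (x \<otimes>\<^bsub>G\<^esub> c) \<noteq> f x"
        "\<And>x d. x \<in> carrier G \<Longrightarrow> d \<in> H \<Longrightarrow> f (x \<otimes>\<^bsub>G\<^esub> d) = f x"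
      using normal.three_coloring_of_cyclic_quotient[OF normal] by blast
    thus ?thesis
      using sub by (intro exI[of _ f]) blast
  qed
  then obtain f :: "'a \<Rightarrow> 'a \<Rightarrow> nat" where f: "\<And>c x. c \<in> C \<Longrightarrow> f c x < 3"
      "\<And>c x. c \<in> C \<Longrightarrow> x \<in> carrier G \<Longrightarrow> f c (x \<otimes>\<^bsub>G\<^esub> c) \<noteq> f c x"
      "\<And>c x d. c \<in> C \<Longrightarrow> x \<in> carrier G \<Longrightarrow> d \<in> C - {c} \<Longrightarrow> f c (x \<otimes>\<^bsub>G\<^esub> d) = f c x"
    by metis
  define F where "F x = (\<Sum>c\<in>C. f c x) mod 3" for x
  have step: "F (x \<otimes>\<^bsub>G\<^esub> d) \<noteq> F x" if "x \<in> carrier G" "d \<in> C" for x d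
  proof
    assume "F (x \<otimes>\<^bsub>G\<^esub> d) = F x"
    moreover have "(\<Sum>c\<in>C. f c y) = f d y + (\<Sum>c\<in>C - {d}. f c y)" for y
      using assms(2) that(2) by (rule sum.remove)
    moreover have "(\<Sum>c\<in>C - {d}. f c (x \<otimes>\<^bsub>G\<^esub> d)) = (\<Sum>c\<in>C - {d}. f c x)"
      using that f(3) by (intro sum.cong) auto
    ultimately have "[f d (x \<otimes>\<^bsub>G\<^esub> d) + (\<Sum>c\<in>C - {d}. f c x) = f d x + (\<Sum>c\<in>C - {d}. f c x)] (mod 3)"
      by (simp add: F_def cong_def)
    \<comment> \<open>Cancelling the common sum leaves a congruence modulo 3 between two numbers
      below 3, hence an equality.\<close>
    hence "f d (x \<otimes>\<^bsub>G\<^esub> d) = f d x"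
      unfolding cong_add_rcancel_nat using f(1)[OF that(2)] by (simp add: cong_def)
    thus False
      using f(2) that by blast
  qed
  \<comment> \<open>Such a \<open>v\<close> arises from \<open>u\<close> by right multiplication
    with a generator.\<close>
  have edge: "F u \<noteq> F v" if uv: "u \<in> carrier G" "v \<in> carrier G" "inv\<^bsub>G\<^esub> u \<otimes>\<^bsub>G\<^esub> v \<in> C" for u v
    using step[OF uv(1,3)] uv(1,2) by (metis inv_closed l_one m_assoc r_inv)
  show ?thesis
    unfolding colorable_def
  proof (intro exI[of _ F] conjI allI impI)
    show "F \<in> verts (with_proj (cayley_graph G C)) \<rightarrow> {..<3}"
      by (simp add: F_def)
    fix u v
    assume "(u, v) \<in> arcs_ends (with_proj (cayley_graph G C))"
    hence "u \<in> carrier G" "v \<in> carrier G" "inv\<^bsub>G\<^esub> u \<otimes>\<^bsub>G\<^esub> v \<in> C \<or> inv\<^bsub>G\<^esub> v \<otimes>\<^bsub>G\<^esub> u \<in> C"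
      by (auto simp: cayley_graph_def arcs_ends_conv)
    \<comment> \<open>The second disjunct is the first with \<open>u\<close> and \<open>v\<close>
      exchanged.\<close>
    thus "F u \<noteq> F v"
      using edge[of u v] edge[of v u] by auto
  qed
qed

end
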